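(* Let $\gamma\in[0,1]$ and let $\chi_\gamma$ be the Choi matrix of the amplitude damping channel $\mathcal E_\gamma$. Every qubit channel $\mathcal E_{\mathrm{sim}}$ that is simulable by noisy teleportation over the resource state $\chi_\gamma$ (for some classical channel $\Pi$) can be uniquely decomposed as $$\mathcal E_{\mathrm{sim}}=\sigma_x^{u}\circ\mathcal E_\eta\circ\mathcal E_P,$$ where $u\in\{0,1\}$, $\sigma_x$ denotes the unitary channel $\rho\mapsto\sigma_x\rho\sigma_x^\dagger$, $\mathcal E_\eta$ is an amplitude damping channel with parameter $\eta$, and $\mathcal E_P$ is a Pauli channel with parameters $\mathbf q=(q_1,q_2,q_3)$ belonging to the tetrahedron $\mathcal T$.
   Context: $(\sigma_0,\sigma_1,\sigma_2,\sigma_3)=(I,\sigma_x,\sigma_y,\sigma_z)$ are the Pauli matrices. The Bloch vector $(x,y,z)$ of a qubit state $\rho$ is defined by $\rho=\frac12(I+x\sigma_x+y\sigma_y+z\sigma_z)$, and qubit channels are described by their action on Bloch vectors. For $\gamma\in[0,1]$, the amplitude damping channel $\mathcal E_\gamma$ acts as $(x,y,z)\mapsto(\sqrt{1-\gamma}\,x,\sqrt{1-\gamma}\,y,\gamma+(1-\gamma)z)$. Its Choi matrix $\chi_\gamma=(\mathbb I\otimes\mathcal E_\gamma)(|\Phi\rangle\langle\Phi|)$, with $|\Phi\rangle=\frac1{\sqrt2}(|00\rangle+|11\rangle)$, is, in the basis $|00\rangle,|01\rangle,|10\rangle,|11\rangle$, $$\chi_\gamma=\begin{pmatrix}\frac12&0&0&\frac{\sqrt{1-\gamma}}2\\0&0&0&0\\0&0&\frac\gamma2&0\\\frac{\sqrt{1-\gamma}}2&0&0&\frac{1-\gamma}2\end{pmatrix}.$$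 $\mathcal T$ is the tetrahedron with vertices $(1,-1,1),(1,1,-1),(-1,-1,-1),(-1,1,1)$ (convex hull). The Pauli channel with parameters $\mathbf q=(q_1,q_2,q_3)\in\mathcal T$ acts as $(x,y,z)\mapsto(q_1x,-q_2y,q_3z)$. Bell projectors: $E_0=|\Phi^+\rangle\langle\Phi^+|$, $E_1=|\Psi^+\rangle\langle\Psi^+|$, $E_2=|\Psi^-\rangle\langle\Psi^-|$, $E_3=|\Phi^-\rangle\langle\Phi^-|$, where $|\Phi^\pm\rangle=\frac1{\sqrt2}(|00\rangle\pm|11\rangle)$ and $|\Psi^\pm\rangle=\frac1{\sqrt2}(|01\rangle\pm|10\rangle)$. A classical channel is a family $\Pi=\{p_{l|k}\}_{k,l\in\{0,1,2,3\}}$ with $p_{l|k}\ge0$ and $\sum_lp_{l|k}=1$ for every $k$. The channel simulated by noisy teleportation over a two-qubit state $\tau_{AB}$ with classical channel $\Pi$ (Bell measurement $\{E_k\}$ on input qubit $C$ and $A$; on outcome $k$ Bob applies $\sigma_l$ to $B$ with probability $p_{l|k}$) is $$\rho\mapsto\sum_{k,l=0}^3 p_{l|k}\;\sigma_l\,\mathrm{Tr}_{CA}\big[(E_k)_{CA}(\rho_C\otimes\tau_{AB})\big]\,\sigma_l .$$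
   Formalization: Full uniqueness is false when η=0 (u=0,q and u=1,(q1,-q2,-q3) give the same channel) or η=1 (every q works); proved instead: existence always, η unique, u unique if η≠0, q unique given u if η≠1, and at η=0 two decompositions with different u are related by that reflection. *)

theory Defs
  imports "HOL-Analysis.Analysis"
begin

text \<open>
  The computational basis states \<open>|0\<rangle>\<close>, \<open>|1\<rangle>\<close> of a qubit are indexed by the elements \<open>0\<close>, \<open>1\<close> of
  the type \<open>2\<close>, those of a composite system by tuples of such elements.  (In the type \<open>2\<close> the
  numeral \<open>2\<close> equals \<open>0\<close>, so \<open>UNIV = {0, 1}\<close>.)
\<close>

type_synonym qubit_op = "complex^2^2"
type_synonym two_qubit_op = "complex^(2 \<times> 2)^(2 \<times> 2)"
type_synonym three_qubit_op = "complex^(2 \<times> 2 \<times> 2)^(2 \<times> 2 \<times> 2)"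
type_synonym qubit_map = "qubit_op \<Rightarrow> qubit_op"

definition ket :: "'n::finite \<Rightarrow> complex^'n" where
  "ket i = axis i 1"

definition ketbra :: "complex^'n \<Rightarrow> complex^'m \<Rightarrow> complex^'m^'n" where
  "ketbra v w = (\<chi> i j. v $ i * cnj (w $ j))"

definition dagger :: "complex^'n^'m \<Rightarrow> complex^'m^'n" where
  "dagger A = (\<chi> i j. cnj (A $ j $ i))"

definition sigma_x :: qubit_op where
  "sigma_x = (\<chi> i j. if i = j then 0 else 1)"

definition sigma_y :: qubit_op where
  "sigma_y = (\<chi> i j. if i = j then 0 else if i = 0 then - \<i> else \<i>)"

definition sigma_z :: qubit_op where
  "sigma_z = (\<chi> i j. if i \<noteq> j then 0 else if i = 0 then 1 else - 1)"

definition pauli :: "nat \<Rightarrow> qubit_op" where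
  "pauli k = [mat 1, sigma_x, sigma_y, sigma_z] ! k"

definition bloch_op :: "complex \<Rightarrow> complex \<Rightarrow> complex \<Rightarrow> complex \<Rightarrow> qubit_op" where
  "bloch_op t x y z =
     (\<chi> i j. (t * mat 1 $ i $ j + x * sigma_x $ i $ j + y * sigma_y $ i $ j + z * sigma_z $ i $ j) / 2)"

text \<open>
  A state with Bloch vector \<open>(x, y, z)\<close> is \<open>bloch_op 1 x y z\<close>; an arbitrary operator \<open>\<rho>\<close> is
  \<open>bloch_op t x y z\<close> for the complex Pauli coordinates \<open>t = Tr \<rho>\<close>, \<open>x = Tr (\<sigma>\<^sub>x \<rho>)\<close> and so on.  A
  channel given by an affine action on Bloch vectors is represented by its unique complex-linear
  extension to all operators, in which the constant part of the affine action is multiplied by \<open>t\<close>.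
\<close>

definition amp_damp :: "real \<Rightarrow> qubit_map" where
  "amp_damp \<gamma> \<rho> =
     (let t = trace \<rho>; x = trace (sigma_x ** \<rho>); y = trace (sigma_y ** \<rho>); z = trace (sigma_z ** \<rho>)
      in bloch_op t (sqrt (1 - \<gamma>) * x) (sqrt (1 - \<gamma>) * y) (\<gamma> * t + (1 - \<gamma>) * z))"

definition pauli_channel :: "real \<times> real \<times> real \<Rightarrow> qubit_map" where
  "pauli_channel q \<rho> =
     (let (q1, q2, q3) = q;
          t = trace \<rho>; x = trace (sigma_x ** \<rho>); y = trace (sigma_y ** \<rho>); z = trace (sigma_z ** \<rho>)
      in bloch_op t (q1 * x) (- q2 * y) (q3 * z))"

definition tetrahedron :: "(real \<times> real \<times> real) set" where
  "tetrahedron = convex hull {(1, -1, 1), (1, 1, -1), (-1, -1, -1), (-1, 1, 1)}"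

definition unitary_channel :: "qubit_op \<Rightarrow> qubit_map" where
  "unitary_channel U \<rho> = U ** \<rho> ** dagger U"

definition Phi_plus :: "complex^(2 \<times> 2)" where
  "Phi_plus = (1 / sqrt 2) *\<^sub>R (ket (0, 0) + ket (1, 1))"

definition Phi_minus :: "complex^(2 \<times> 2)" where
  "Phi_minus = (1 / sqrt 2) *\<^sub>R (ket (0, 0) - ket (1, 1))"

definition Psi_plus :: "complex^(2 \<times> 2)" where
  "Psi_plus = (1 / sqrt 2) *\<^sub>R (ket (0, 1) + ket (1, 0))"

definition Psi_minus :: "complex^(2 \<times> 2)" where
  "Psi_minus = (1 / sqrt 2) *\<^sub>R (ket (0, 1) - ket (1, 0))"

definition bell_proj :: "nat \<Rightarrow> two_qubit_op" where
  "bell_proj k = (let v = [Phi_plus, Psi_plus, Psi_minus, Phi_minus] ! k in ketbra v v)"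

text \<open>\<open>\<I> \<otimes> \<E>\<close>: a linear map \<open>\<E>\<close> acts on each block \<open>\<langle>a| M |a'\<rangle>\<close> of the first qubit.\<close>

definition id_tensor :: "qubit_map \<Rightarrow> two_qubit_op \<Rightarrow> two_qubit_op" where
  "id_tensor \<E> M = (\<chi> r s. \<E> (\<chi> i j. M $ (fst r, i) $ (fst s, j)) $ snd r $ snd s)"

definition choi :: "qubit_map \<Rightarrow> two_qubit_op" where
  "choi \<E> = id_tensor \<E> (ketbra Phi_plus Phi_plus)"

text \<open>Three-qubit systems are ordered \<open>C, A, B\<close>.\<close>

definition tensor_C_AB :: "qubit_op \<Rightarrow> two_qubit_op \<Rightarrow> three_qubit_op" where
  "tensor_C_AB \<rho> \<tau> = (\<chi> r s. \<rho> $ fst r $ fst s * \<tau> $ snd r $ snd s)"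

definition lift_CA :: "two_qubit_op \<Rightarrow> three_qubit_op" where
  "lift_CA M = (\<chi> r s. case (r, s) of ((c, a, b), (c', a', b')) \<Rightarrow>
     M $ (c, a) $ (c', a') * (if b = b' then 1 else 0))"

definition ptrace_CA :: "three_qubit_op \<Rightarrow> qubit_op" where
  "ptrace_CA M = (\<chi> b b'. \<Sum>c\<in>UNIV. \<Sum>a\<in>UNIV. M $ (c, a, b) $ (c, a, b'))"

text \<open>\<open>p l k\<close> stands for the conditional probability \<open>p\<^bsub>l|k\<^esub>\<close>.\<close>

definition classical_channel :: "(nat \<Rightarrow> nat \<Rightarrow> real) \<Rightarrow> bool" where
  "classical_channel p \<longleftrightarrow> (\<forall>k\<in>{0..3}. (\<forall>l\<in>{0..3}. 0 \<le> p l k) \<and> (\<Sum>l=0..3. p l k) = 1)"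

definition noisy_teleport :: "two_qubit_op \<Rightarrow> (nat \<Rightarrow> nat \<Rightarrow> real) \<Rightarrow> qubit_map" where
  "noisy_teleport \<tau> p \<rho> =
     (\<Sum>k=0..3. \<Sum>l=0..3. p l k *\<^sub>R
        (pauli l ** ptrace_CA (lift_CA (bell_proj k) ** tensor_C_AB \<rho> \<tau>) ** pauli l))"

definition teleport_simulable :: "two_qubit_op \<Rightarrow> qubit_map \<Rightarrow> bool" where
  "teleport_simulable \<tau> \<E> \<longleftrightarrow> (\<exists>p. classical_channel p \<and> \<E> = noisy_teleport \<tau> p)"

text \<open>
  The triple \<open>(u, \<eta>, q)\<close> is redundant in two degenerate cases: \<open>amp_damp 1\<close> is constant on states,
  so every \<open>q\<close> serves when \<open>\<eta> = 1\<close>; and \<open>amp_damp 0\<close> is the identity while \<open>\<sigma>\<^sub>x\<close> itself is a Pauli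
  channel, so \<open>(u, 0, (q1, q2, q3))\<close> and \<open>(1 - u, 0, (q1, - q2, - q3))\<close> give the same channel.
\<close>

definition pauli_damping_decomposition ::
    "qubit_map \<Rightarrow> nat \<Rightarrow> real \<Rightarrow> real \<times> real \<times> real \<Rightarrow> bool" where
  "pauli_damping_decomposition \<E> u \<eta> q \<longleftrightarrow>
     u \<in> {0, 1} \<and> \<eta> \<in> {0..1} \<and> q \<in> tetrahedron \<and>
     \<E> = (unitary_channel sigma_x ^^ u) \<circ> amp_damp \<eta> \<circ> pauli_channel q"


subsection \<open>Agreement with the Bloch-vector and matrix descriptions\<close>

lemma UNIV_qubit: "(UNIV :: 2 set) = {0, 1}"
proof -
  have "(2 :: 2) = 0" by simp
  then show ?thesis using UNIV_2 by (metis insert_commute)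
qed

lemma sum_qubit: "sum f (UNIV :: 2 set) = f 0 + f 1"
  by (simp add: UNIV_qubit)

lemma forall_qubit: "(\<forall>i::2. P i) \<longleftrightarrow> P 0 \<and> P 1"
  using UNIV_qubit by (metis UNIV_I empty_iff insert_iff)

lemma bloch_op_coords:
  "trace (bloch_op t x y z) = t"
  "trace (sigma_x ** bloch_op t x y z) = x"
  "trace (sigma_y ** bloch_op t x y z) = y"
  "trace (sigma_z ** bloch_op t x y z) = z"
  by (simp_all add: trace_def bloch_op_def matrix_matrix_mult_def sum_qubit mat_def
      sigma_x_def sigma_y_def sigma_z_def field_simps)

lemma bloch_op_trace:
  "bloch_op (trace \<rho>) (trace (sigma_x ** \<rho>)) (trace (sigma_y ** \<rho>)) (trace (sigma_z ** \<rho>)) = \<rho>"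
  by (simp add: vec_eq_iff forall_qubit trace_def bloch_op_def matrix_matrix_mult_def sum_qubit
      mat_def sigma_x_def sigma_y_def sigma_z_def field_simps)

lemma amp_damp_bloch:
  "amp_damp \<gamma> (bloch_op 1 x y z) =
     bloch_op 1 (sqrt (1 - \<gamma>) * x) (sqrt (1 - \<gamma>) * y) (\<gamma> + (1 - \<gamma>) * z)"
  by (simp add: amp_damp_def bloch_op_coords)

lemma pauli_channel_bloch:
  "pauli_channel (q1, q2, q3) (bloch_op 1 x y z) = bloch_op 1 (q1 * x) (- q2 * y) (q3 * z)"
  by (simp add: pauli_channel_def bloch_op_coords)

lemma choi_amp_damp:
  "choi (amp_damp \<gamma>) $ r $ s =
     (if r = (0, 0) \<and> s = (0, 0) then 1 / 2
      else if r = (0, 0) \<and> s = (1, 1) \<or> r = (1, 1) \<and> s = (0, 0) then sqrt (1 - \<gamma>) / 2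
      else if r = (1, 0) \<and> s = (1, 0) then \<gamma> / 2
      else if r = (1, 1) \<and> s = (1, 1) then (1 - \<gamma>) / 2
      else 0)"
proof -
  have c: "complex_of_real (sqrt 2) * complex_of_real (sqrt 2) = 2"
    by (simp flip: of_real_mult)
  have "\<forall>a b a' b'. choi (amp_damp \<gamma>) $ (a, b) $ (a', b') =
     (if (a, b) = (0, 0) \<and> (a', b') = (0, 0) then 1 / 2
      else if (a, b) = (0, 0) \<and> (a', b') = (1, 1) \<or> (a, b) = (1, 1) \<and> (a', b') = (0, 0)
        then sqrt (1 - \<gamma>) / 2
      else if (a, b) = (1, 0) \<and> (a', b') = (1, 0) then \<gamma> / 2
      else if (a, b) = (1, 1) \<and> (a', b') = (1, 1) then (1 - \<gamma>) / 2
      else 0)"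
    by (simp add: forall_qubit choi_def id_tensor_def amp_damp_def bloch_op_def ketbra_def
        Phi_plus_def ket_def axis_def Let_def trace_def matrix_matrix_mult_def sum_qubit mat_def
        sigma_x_def sigma_y_def sigma_z_def scaleR_conv_of_real [where 'a = complex] c field_simps)
  then show ?thesis
    by (cases r; cases s) blast
qed

end

theory Submission
  imports Defs
begin

text \<open>
  Teleporting through \<open>\<chi>\<^sub>\<gamma>\<close> with Bell outcome \<open>k\<close> yields \<open>\<sigma>\<^sub>k\<close> followed by \<open>\<E>\<^sub>\<gamma>\<close>, so the simulated
  channel acts as \<open>(x, y, z) \<mapsto> (\<surd>(1-\<gamma>) A x, \<surd>(1-\<gamma>) B y, \<gamma> D + (1-\<gamma>) C z)\<close>, where \<open>A, B, C, D\<close>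
  are averages of products of signs with \<open>\<bar>A + B\<bar> \<le> 1 + C\<close>, \<open>\<bar>A - B\<bar> \<le> 1 - C\<close> and \<open>\<bar>D\<bar> \<le> 1\<close>.
  The translation of the Bloch ball forces \<open>\<eta> = \<gamma> \<bar>D\<bar>\<close> and \<open>u = 1\<close> for \<open>D < 0\<close>, and then
  \<open>q\<close> is forced by the linear part if \<open>\<eta> \<noteq> 1\<close>.  That \<open>q\<close> lies in the tetrahedron amounts to
  \<open>\<surd>((1-\<eta>)(1-\<gamma>)) w \<le> (1-\<eta>) + (1-\<gamma>) (w - 1)\<close> for \<open>w = 1 \<plusminus> C\<close>; it follows from the inequality
  of arithmetic and geometric means, since \<open>w \<le> 2\<close> and \<open>\<eta> \<le> \<gamma>\<close>.
\<close>

section \<open>Affine normal form of channels\<close>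

text \<open>Common normal form of simulated channels and decompositions: a diagonal linear part and
  a translation along z. Comparing maps thereby reduces to comparing four real parameters.\<close>

definition bloch_affine :: "real \<Rightarrow> real \<Rightarrow> real \<Rightarrow> real \<Rightarrow> qubit_map" where
  "bloch_affine a b c d \<rho> =
     bloch_op (trace \<rho>) (a * trace (sigma_x ** \<rho>)) (b * trace (sigma_y ** \<rho>))
       (d * trace \<rho> + c * trace (sigma_z ** \<rho>))"

lemma bloch_affine_bloch_op:
  "bloch_affine a b c d (bloch_op t x y z) = bloch_op t (a * x) (b * y) (d * t + c * z)"
  by (simp add: bloch_affine_def bloch_op_coords)

lemma bloch_op_eq_iff:
  "bloch_op t x y z = bloch_op t' x' y' z' \<longleftrightarrow> t = t' \<and> x = x' \<and> y = y' \<and> z = z'"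
  by (metis bloch_op_coords)

lemma bloch_affine_eq_iff:
  "bloch_affine a b c d = bloch_affine a' b' c' d' \<longleftrightarrow> a = a' \<and> b = b' \<and> c = c' \<and> d = d'"
proof
  assume eq: "bloch_affine a b c d = bloch_affine a' b' c' d'"
  \<comment> \<open>The first operator reads off \<open>a\<close>, \<open>b\<close>,
    \<open>d\<close>; the traceless second one isolates \<open>c\<close>.\<close>
  have "bloch_affine a b c d (bloch_op 1 1 1 0) = bloch_affine a' b' c' d' (bloch_op 1 1 1 0)"
    "bloch_affine a b c d (bloch_op 0 0 0 1) = bloch_affine a' b' c' d' (bloch_op 0 0 0 1)"
    using eq by simp_all
  then show "a = a' \<and> b = b' \<and> c = c' \<and> d = d'"
    by (simp add: bloch_affine_bloch_op bloch_op_eq_iff)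
qed simp

lemma bloch_op_scaleR_sum:
  fixes c :: "'i \<Rightarrow> real" and t x y z :: "'i \<Rightarrow> complex"
  shows "(\<Sum>i\<in>S. c i *\<^sub>R bloch_op (t i) (x i) (y i) (z i)) =
    bloch_op (\<Sum>i\<in>S. c i * t i) (\<Sum>i\<in>S. c i * x i) (\<Sum>i\<in>S. c i * y i) (\<Sum>i\<in>S. c i * z i)"
  by (induction S rule: infinite_finite_induct)
    (simp_all add: vec_eq_iff bloch_op_def scaleR_conv_of_real[where 'a = complex] algebra_simps add_divide_distrib
      diff_divide_distrib)

section \<open>Teleportation through the Choi matrix\<close>

text \<open>The sign that \<open>sigma_x\<close> acquires under conjugation by
  \<open>pauli k\<close>, which is 1 exactly when the two commute; \<open>sign_y\<close> and
  \<open>sign_z\<close> are the analogues for the other axes.\<close>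

definition sign_x :: "nat \<Rightarrow> real" where
  "sign_x k = (if k \<in> {0, 1} then 1 else - 1)"

definition sign_y :: "nat \<Rightarrow> real" where
  "sign_y k = (if k \<in> {0, 2} then 1 else - 1)"

definition sign_z :: "nat \<Rightarrow> real" where
  "sign_z k = (if k \<in> {0, 3} then 1 else - 1)"

lemma atMost_3_cases:
  assumes "k \<in> {0..3::nat}"
  obtains "k = 0" | "k = 1" | "k = 2" | "k = 3"
  using assms by fastforce

lemma pauli_conj_bloch_op:
  fixes x y z :: complex
  assumes "k \<in> {0..3}"
  shows "pauli k ** bloch_op t x y z ** pauli k =
    bloch_op t (sign_x k * x) (sign_y k * y) (sign_z k * z)"
  using assms
  by (cases rule: atMost_3_cases)
    (simp_all add: vec_eq_iff forall_qubit bloch_op_def matrix_matrix_mult_def sum_qubit mat_def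
      pauli_def sigma_x_def sigma_y_def sigma_z_def sign_x_def sign_y_def sign_z_def field_simps)

lemma ptrace_CA_lift_tensor:
  "ptrace_CA (lift_CA M ** tensor_C_AB \<rho> \<tau>) $ b $ b' =
     (\<Sum>c\<in>UNIV. \<Sum>a\<in>UNIV. \<Sum>c'\<in>UNIV. \<Sum>a'\<in>UNIV.
        M $ (c, a) $ (c', a') * \<rho> $ c' $ c * \<tau> $ (a', b) $ (a, b'))"
proof -
  have "(\<Sum>j\<in>UNIV. f j) = (\<Sum>c\<in>UNIV. \<Sum>a\<in>UNIV. \<Sum>b\<in>UNIV. f (c, a, b))"
    for f :: "2 \<times> 2 \<times> 2 \<Rightarrow> complex"
    by (simp add: sum.cartesian_product flip: UNIV_Times_UNIV)
  then show ?thesis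
    by (simp add: ptrace_CA_def lift_CA_def tensor_C_AB_def matrix_matrix_mult_def
        if_distrib[of "\<lambda>u. _ * u"] if_distrib[of "\<lambda>u. u * _"] mult.assoc cong: if_cong)
qed

text \<open>Up to a phase, Bell vector \<open>k\<close> is \<open>Phi_plus\<close> with
  \<open>pauli k\<close> applied to its first qubit, so outcome \<open>k\<close> is outcome 0 with
  the input conjugated by \<open>pauli k\<close>. Each outcome has probability 1/4.\<close>

lemma teleport_outcome:
  assumes "k \<in> {0..3}"
  shows "ptrace_CA (lift_CA (bell_proj k) ** tensor_C_AB \<rho> (choi (amp_damp \<gamma>))) =
    (1 / 4) *\<^sub>R amp_damp \<gamma> (pauli k ** \<rho> ** pauli k)"
proof -
  have c: "complex_of_real (sqrt 2) * complex_of_real (sqrt 2) = 2"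
    by (simp flip: of_real_mult)
  show ?thesis
    using assms unfolding vec_eq_iff forall_qubit ptrace_CA_lift_tensor
    by (cases rule: atMost_3_cases)
      (simp_all add: choi_amp_damp sum_qubit
        bell_proj_def ketbra_def Phi_plus_def Phi_minus_def Psi_plus_def Psi_minus_def ket_def
        axis_def amp_damp_def bloch_op_def Let_def trace_def matrix_matrix_mult_def mat_def
        pauli_def sigma_x_def sigma_y_def sigma_z_def scaleR_conv_of_real[where 'a = complex] c field_simps)
qed

lemma noisy_teleport_amp_damp:
  assumes "classical_channel p"
  obtains A B C D where
    "noisy_teleport (choi (amp_damp \<gamma>)) p =
       bloch_affine (sqrt (1 - \<gamma>) * A) (sqrt (1 - \<gamma>) * B) ((1 - \<gamma>) * C) (\<gamma> * D)"
    "\<bar>A + B\<bar> \<le> 1 + C" "\<bar>A - B\<bar> \<le> 1 - C" "\<bar>D\<bar> \<le> 1"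
proof -
  define S where "S = {0..3::nat} \<times> {0..3::nat}"
  define P where "P i = p (snd i) (fst i) / 4" for i
  define A where "A = (\<Sum>i\<in>S. P i * (sign_x (fst i) * sign_x (snd i)))"
  define B where "B = (\<Sum>i\<in>S. P i * (sign_y (fst i) * sign_y (snd i)))"
  define C where "C = (\<Sum>i\<in>S. P i * (sign_z (fst i) * sign_z (snd i)))"
  \<comment> \<open>Only the correction \<open>l\<close> enters: the damping creates its translation
    after \<open>pauli k\<close> has acted.\<close>
  define D where "D = (\<Sum>i\<in>S. P i * sign_z (snd i))"
  have P_nonneg: "0 \<le> P i" if "i \<in> S" for i
    using assms that by (auto simp: classical_channel_def S_def P_def)
  have sum_P: "(\<Sum>i\<in>S. P i) = 1"
  proof -
    have "(\<Sum>i\<in>S. P i) = (\<Sum>k=0..3. (\<Sum>l=0..3. p l k) / 4)"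
      by (simp add: S_def P_def sum_divide_distrib sum.cartesian_product case_prod_unfold)
    also have "\<dots> = (\<Sum>k=0..3::nat. 1 / 4)"
      using assms by (intro sum.cong) (auto simp: classical_channel_def)
    finally show ?thesis by simp
  qed
  have average_mono: "(\<Sum>i\<in>S. P i * f i) \<le> (\<Sum>i\<in>S. P i * g i)" if "\<And>i. i \<in> S \<Longrightarrow> f i \<le> g i" for f g
    using that P_nonneg by (intro sum_mono mult_left_mono) auto
  \<comment> \<open>For each pair \<open>(k, l)\<close> the three sign products \<open>a\<close>,
    \<open>b\<close>, \<open>c\<close> are \<plusminus>1 with product 1, so
    \<open>\<bar>a + b\<bar> = 1 + c\<close> and \<open>\<bar>a - b\<bar> = 1 - c\<close>; averaging
    gives the claim.\<close>
  have "A + B \<le> 1 + C" "- (A + B) \<le> 1 + C" "A - B \<le> 1 - C" "- (A - B) \<le> 1 - C"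
    using average_mono[of "\<lambda>(k, l). sign_x k * sign_x l + sign_y k * sign_y l"
        "\<lambda>(k, l). 1 + sign_z k * sign_z l"]
      average_mono[of "\<lambda>(k, l). - (sign_x k * sign_x l + sign_y k * sign_y l)"
        "\<lambda>(k, l). 1 + sign_z k * sign_z l"]
      average_mono[of "\<lambda>(k, l). sign_x k * sign_x l - sign_y k * sign_y l"
        "\<lambda>(k, l). 1 - sign_z k * sign_z l"]
      average_mono[of "\<lambda>(k, l). - (sign_x k * sign_x l - sign_y k * sign_y l)"
        "\<lambda>(k, l). 1 - sign_z k * sign_z l"]
    by (auto simp: A_def B_def C_def S_def sum_P[unfolded S_def] case_prod_unfold algebra_simps
        sum.distrib sum_subtractf sum_negf sign_x_def sign_y_def sign_z_def elim!: atMost_3_cases)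
  moreover have "D \<le> 1" "- D \<le> 1"
    using average_mono[of "\<lambda>(k, l). sign_z l" "\<lambda>_. 1"]
      average_mono[of "\<lambda>(k, l). - sign_z l" "\<lambda>_. 1"]
    by (auto simp: D_def sum_P case_prod_unfold sign_z_def sum_negf)
  moreover have "noisy_teleport (choi (amp_damp \<gamma>)) p \<rho> =
      bloch_affine (sqrt (1 - \<gamma>) * A) (sqrt (1 - \<gamma>) * B) ((1 - \<gamma>) * C) (\<gamma> * D) \<rho>" for \<rho>
  proof -
    obtain t x y z where \<rho>: "\<rho> = bloch_op t x y z"
      by (metis bloch_op_trace)
    have outcome: "pauli l ** ptrace_CA (lift_CA (bell_proj k) **
          tensor_C_AB \<rho> (choi (amp_damp \<gamma>))) ** pauli l =
        (1 / 4) *\<^sub>R bloch_op t (sqrt (1 - \<gamma>) * (sign_x k * sign_x l) * x)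
          (sqrt (1 - \<gamma>) * (sign_y k * sign_y l) * y)
          (\<gamma> * sign_z l * t + (1 - \<gamma>) * (sign_z k * sign_z l) * z)"
      if "k \<in> {0..3}" "l \<in> {0..3}" for k l
      using that
      by (simp add: \<rho> teleport_outcome pauli_conj_bloch_op amp_damp_def bloch_op_coords
          scalar_matrix_assoc[symmetric] matrix_scalar_ac bloch_op_eq_iff algebra_simps)
    have "noisy_teleport (choi (amp_damp \<gamma>)) p \<rho> =
      (\<Sum>i\<in>S. P i *\<^sub>R bloch_op t (sqrt (1 - \<gamma>) * (sign_x (fst i) * sign_x (snd i)) * x)
          (sqrt (1 - \<gamma>) * (sign_y (fst i) * sign_y (snd i)) * y)
          (\<gamma> * sign_z (snd i) * t + (1 - \<gamma>) * (sign_z (fst i) * sign_z (snd i)) * z))"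
      unfolding noisy_teleport_def S_def P_def sum.cartesian_product case_prod_unfold
      by (intro sum.cong) (simp_all add: outcome mem_Times_iff del: of_real_mult)
    also have "\<dots> = bloch_op t (sqrt (1 - \<gamma>) * A * x) (sqrt (1 - \<gamma>) * B * y)
        (\<gamma> * D * t + (1 - \<gamma>) * C * z)"
    proof -
      have "(\<Sum>i\<in>S. P i * t) = t"
        by (simp add: sum_P flip: sum_distrib_right of_real_sum)
      then show ?thesis
        unfolding bloch_op_scaleR_sum bloch_op_eq_iff
        by (simp add: A_def B_def C_def D_def sum_distrib_left sum_distrib_right algebra_simps
            sum.distrib sum_subtractf)
    qed
    finally show ?thesis
      by (simp add: \<rho> bloch_affine_bloch_op)
  qed
  ultimately show thesis
    by (intro that[of A B C D]) (auto simp: abs_le_iff)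
qed

section \<open>Existence of the decomposition\<close>

text \<open>The entries of \<open>w\<close> are the barycentric coordinates of the point, and the
  hypotheses say that all four are nonnegative.\<close>

lemma tetrahedronI:
  assumes "\<bar>q1 - q2\<bar> \<le> 1 + q3" "\<bar>q1 + q2\<bar> \<le> 1 - q3"
  shows "(q1, q2, q3) \<in> tetrahedron"
proof -
  define w where "w = (!) [(1 + q1 - q2 + q3) / 4, (1 + q1 + q2 - q3) / 4,
    (1 - q1 - q2 - q3) / 4, (1 - q1 + q2 + q3) / 4]"
  define v :: "nat \<Rightarrow> real \<times> real \<times> real" where
    "v = (!) [(1, - 1, 1), (1, 1, - 1), (- 1, - 1, - 1), (- 1, 1, 1)]"
  have "(\<Sum>i\<in>{0, 1, 2, 3}. w i *\<^sub>R v i) \<in> tetrahedron"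
    unfolding tetrahedron_def
  proof (rule convex_sum[OF _ convex_convex_hull])
    show "0 \<le> w i" if "i \<in> {0, 1, 2, 3}" for i
      using that assms by (auto simp: w_def)
    show "v i \<in> convex hull {(1, - 1, 1), (1, 1, - 1), (- 1, - 1, - 1), (- 1, 1, 1)}"
      if "i \<in> {0, 1, 2, 3}" for i
      using that by (auto simp: v_def intro!: hull_inc)
  qed (simp_all add: w_def field_simps)
  also have "(\<Sum>i\<in>{0, 1, 2, 3}. w i *\<^sub>R v i) = (q1, q2, q3)"
    by (simp add: w_def v_def field_simps)
  finally show ?thesis .
qed

lemma unitary_sigma_x_bloch_op:
  "unitary_channel sigma_x (bloch_op t x y z) = bloch_op t x (- y) (- z)"
  by (simp add: vec_eq_iff forall_qubit unitary_channel_def dagger_def bloch_op_def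
      matrix_matrix_mult_def sum_qubit mat_def sigma_x_def sigma_y_def sigma_z_def field_simps)

text \<open>Conjugation by \<open>sigma_x\<close> negates the y and z coordinates, whence
  \<open>(- 1) ^ u\<close> on all parameters but the first. The further minus at \<open>q2\<close>
  is the convention of \<open>pauli_channel\<close>.\<close>

lemma decomposition_eq_bloch_affine:
  assumes "u \<in> {0, 1}"
  shows "(unitary_channel sigma_x ^^ u) \<circ> amp_damp \<eta> \<circ> pauli_channel (q1, q2, q3) =
    bloch_affine (sqrt (1 - \<eta>) * q1) ((- 1) ^ u * - (sqrt (1 - \<eta>) * q2))
      ((- 1) ^ u * ((1 - \<eta>) * q3)) ((- 1) ^ u * \<eta>)"
proof
  fix \<rho>
  obtain t x y z where \<rho>: "\<rho> = bloch_op t x y z"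
    by (metis bloch_op_trace)
  show "((unitary_channel sigma_x ^^ u) \<circ> amp_damp \<eta> \<circ> pauli_channel (q1, q2, q3)) \<rho> =
    bloch_affine (sqrt (1 - \<eta>) * q1) ((- 1) ^ u * - (sqrt (1 - \<eta>) * q2))
      ((- 1) ^ u * ((1 - \<eta>) * q3)) ((- 1) ^ u * \<eta>) \<rho>"
    using assms
    by (auto simp: \<rho> amp_damp_def pauli_channel_def bloch_op_coords bloch_affine_bloch_op
        unitary_sigma_x_bloch_op bloch_op_eq_iff algebra_simps)
qed

text \<open>For \<open>\<eta> = 1\<close> both quotients are \<open>0\<close> by the convention \<open>x / 0 = 0\<close>; this makes \<open>q = 0\<close> below.\<close>

lemma damping_ratio_bound:
  fixes \<eta> \<gamma> w X :: real
  assumes "0 \<le> \<eta>" "\<eta> \<le> \<gamma>" "\<gamma> \<le> 1" "w \<le> 2" "\<bar>X\<bar> \<le> w"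
  shows "\<bar>sqrt (1 - \<gamma>) * X / sqrt (1 - \<eta>)\<bar> \<le> 1 + (1 - \<gamma>) * (w - 1) / (1 - \<eta>)"
proof (cases "\<eta> = 1")
  case False
  then have pos: "0 < 1 - \<eta>"
    using assms by simp
  have "\<bar>sqrt (1 - \<gamma>) * X / sqrt (1 - \<eta>)\<bar> = sqrt ((1 - \<gamma>) * (1 - \<eta>)) * \<bar>X\<bar> / (1 - \<eta>)"
    using pos assms sqrt_divide_self_eq[of "1 - \<eta>"]
    by (simp add: abs_mult real_sqrt_mult divide_inverse mult_ac)
  also have "\<dots> \<le> ((1 - \<gamma>) + (1 - \<eta>)) / 2 * w / (1 - \<eta>)"
    using pos assms arith_geo_mean_sqrt[of "1 - \<gamma>" "1 - \<eta>"]
    by (intro divide_right_mono mult_mono) auto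
  also have "\<dots> \<le> ((1 - \<eta>) + (1 - \<gamma>) * (w - 1)) / (1 - \<eta>)"
  proof (intro divide_right_mono)
    \<comment> \<open>This product is twice the difference of the two sides.\<close>
    have "0 \<le> (\<gamma> - \<eta>) * (2 - w)"
      using assms by simp
    then show "((1 - \<gamma>) + (1 - \<eta>)) / 2 * w \<le> (1 - \<eta>) + (1 - \<gamma>) * (w - 1)"
      by (simp add: field_simps)
  qed (use pos in simp)
  finally show ?thesis
    using pos by (simp add: add_divide_distrib)
qed simp

lemma pauli_damping_decomposition_bloch_affine:
  fixes \<gamma> A B C D :: real
  assumes \<gamma>: "\<gamma> \<in> {0..1}"
    and AB: "\<bar>A + B\<bar> \<le> 1 + C" "\<bar>A - B\<bar> \<le> 1 - C" and D: "\<bar>D\<bar> \<le> 1"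
  shows "\<exists>u \<eta> q. pauli_damping_decomposition
    (bloch_affine (sqrt (1 - \<gamma>) * A) (sqrt (1 - \<gamma>) * B) ((1 - \<gamma>) * C) (\<gamma> * D)) u \<eta> q"
proof -
  define u :: nat where "u = (if 0 \<le> D then 0 else 1)"
  define \<epsilon> :: real where "\<epsilon> = (- 1) ^ u"
  define \<eta> where "\<eta> = \<gamma> * \<bar>D\<bar>"
  \<comment> \<open>These solve the parameter equations of
    \<open>decomposition_eq_bloch_affine\<close>.\<close>
  define q1 where "q1 = sqrt (1 - \<gamma>) * A / sqrt (1 - \<eta>)"
  define q2 where "q2 = - \<epsilon> * (sqrt (1 - \<gamma>) * B / sqrt (1 - \<eta>))"
  define q3 where "q3 = \<epsilon> * ((1 - \<gamma>) * C / (1 - \<eta>))"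
  have \<eta>: "0 \<le> \<eta>" "\<eta> \<le> \<gamma>" "\<gamma> \<le> 1"
    using \<gamma> D by (auto simp: \<eta>_def mult_left_le)
  have \<epsilon>: "\<epsilon> = 1 \<or> \<epsilon> = - 1"
    by (simp add: \<epsilon>_def u_def)
  have C: "\<bar>C\<bar> \<le> 1"
    using AB by linarith
  have bound: "\<bar>sqrt (1 - \<gamma>) * X / sqrt (1 - \<eta>)\<bar> \<le> 1 + (1 - \<gamma>) * c / (1 - \<eta>)"
    if "\<bar>X\<bar> \<le> 1 + c" "c \<le> 1" for X c
    using damping_ratio_bound[OF \<eta>, of "1 + c" X] that by simp
  \<comment> \<open>Changing the sign of \<open>\<epsilon>\<close> swaps the two inequalities of
    \<open>tetrahedronI\<close>, so the same two bounds serve both cases.\<close>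
  have "(q1, q2, q3) \<in> tetrahedron"
    using bound[of "A + B" C] bound[of "A - B" "- C"] AB C \<epsilon>
    by (intro tetrahedronI)
      (auto simp: q1_def q2_def q3_def algebra_simps add_divide_distrib diff_divide_distrib)
  \<comment> \<open>If \<open>\<eta> = 1\<close> then \<open>\<gamma> = 1\<close>, and both sides
    vanish.\<close>
  moreover have "sqrt (1 - \<eta>) * q1 = sqrt (1 - \<gamma>) * A"
    "\<epsilon> * - (sqrt (1 - \<eta>) * q2) = sqrt (1 - \<gamma>) * B" "\<epsilon> * ((1 - \<eta>) * q3) = (1 - \<gamma>) * C"
    using \<eta> \<epsilon> by (cases "\<eta> = 1"; auto simp: q1_def q2_def q3_def)+
  moreover have "\<epsilon> * \<eta> = \<gamma> * D"
    by (simp add: \<epsilon>_def \<eta>_def u_def)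
  ultimately have "pauli_damping_decomposition
      (bloch_affine (sqrt (1 - \<gamma>) * A) (sqrt (1 - \<gamma>) * B) ((1 - \<gamma>) * C) (\<gamma> * D)) u \<eta> (q1, q2, q3)"
    using \<eta> decomposition_eq_bloch_affine[of u \<eta> q1 q2 q3]
    by (simp add: pauli_damping_decomposition_def \<epsilon>_def u_def)
  then show ?thesis by blast
qed

section \<open>Uniqueness\<close>

text \<open>The translation \<open>(- 1) ^ u * \<eta>\<close> determines \<open>\<eta>\<close> as
  its absolute value and, unless it is 0, also \<open>u\<close>. Cancelling
  \<open>sqrt (1 - \<eta>)\<close> and \<open>1 - \<eta>\<close> in the linear part then gives
  \<open>q\<close>.\<close>

lemma pauli_damping_decomposition_unique:
  assumes "pauli_damping_decomposition \<E> u \<eta> (q1, q2, q3)"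
    and "pauli_damping_decomposition \<E> u' \<eta>' (q1', q2', q3')"
  shows "\<eta>' = \<eta>" "\<eta> \<noteq> 0 \<Longrightarrow> u' = u" "\<eta> \<noteq> 1 \<Longrightarrow> u' = u \<Longrightarrow> (q1', q2', q3') = (q1, q2, q3)"
    "\<eta> = 0 \<Longrightarrow> u' \<noteq> u \<Longrightarrow> (q1', q2', q3') = (q1, - q2, - q3)"
proof -
  have u: "u \<in> {0, 1}" "u' \<in> {0, 1}" and \<eta>: "\<eta> \<in> {0..1}" "\<eta>' \<in> {0..1}"
    using assms by (auto simp: pauli_damping_decomposition_def)
  have eq: "sqrt (1 - \<eta>') * q1' = sqrt (1 - \<eta>) * q1"
    "(- 1) ^ u' * - (sqrt (1 - \<eta>') * q2') = (- 1) ^ u * - (sqrt (1 - \<eta>) * q2)"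
    "(- 1) ^ u' * ((1 - \<eta>') * q3') = (- 1) ^ u * ((1 - \<eta>) * q3)"
    "(- 1) ^ u' * \<eta>' = (- 1) ^ u * \<eta>"
    using assms unfolding pauli_damping_decomposition_def
    by (metis decomposition_eq_bloch_affine bloch_affine_eq_iff)+
  show "\<eta>' = \<eta>" and "\<eta> \<noteq> 0 \<Longrightarrow> u' = u"
    using eq(4) u \<eta> by auto
  with eq(1-3) u show "\<eta> \<noteq> 1 \<Longrightarrow> u' = u \<Longrightarrow> (q1', q2', q3') = (q1, q2, q3)"
    "\<eta> = 0 \<Longrightarrow> u' \<noteq> u \<Longrightarrow> (q1', q2', q3') = (q1, - q2, - q3)"
    by auto
qed

text \<open>Uniqueness is literal for 0 < \<eta> < 1; \<open>\<eta> = 1\<close> leaves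
  \<open>q\<close> free, and \<open>\<eta> = 0\<close> lets \<open>sigma_x\<close> be absorbed into
  the Pauli channel.\<close>

theorem theorem15:
  fixes \<gamma> :: real and \<E> :: qubit_map
  assumes "\<gamma> \<in> {0..1}"
    and "teleport_simulable (choi (amp_damp \<gamma>)) \<E>"
  shows "(\<exists>u \<eta> q. pauli_damping_decomposition \<E> u \<eta> q) \<and>
    (\<forall>u \<eta> q1 q2 q3 u' \<eta>' q'.
       pauli_damping_decomposition \<E> u \<eta> (q1, q2, q3) \<and>
       pauli_damping_decomposition \<E> u' \<eta>' q' \<longrightarrow>
         \<eta>' = \<eta> \<and>
         (\<eta> \<noteq> 0 \<longrightarrow> u' = u) \<and>
         (\<eta> \<noteq> 1 \<and> u' = u \<longrightarrow> q' = (q1, q2, q3)) \<and>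
         (\<eta> = 0 \<and> u' \<noteq> u \<longrightarrow> q' = (q1, - q2, - q3)))"
proof
  obtain p where "classical_channel p" and \<E>: "\<E> = noisy_teleport (choi (amp_damp \<gamma>)) p"
    using assms(2) by (auto simp: teleport_simulable_def)
  then show "\<exists>u \<eta> q. pauli_damping_decomposition \<E> u \<eta> q"
    using noisy_teleport_amp_damp[of p \<gamma>] pauli_damping_decomposition_bloch_affine[OF assms(1)]
    by metis
  show "\<forall>u \<eta> q1 q2 q3 u' \<eta>' q'.
       pauli_damping_decomposition \<E> u \<eta> (q1, q2, q3) \<and>
       pauli_damping_decomposition \<E> u' \<eta>' q' \<longrightarrow>
         \<eta>' = \<eta> \<and>
         (\<eta> \<noteq> 0 \<longrightarrow> u' = u) \<and>
         (\<eta> \<noteq> 1 \<and> u' = u \<longrightarrow> q' = (q1, q2, q3)) \<and>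
         (\<eta> = 0 \<and> u' \<noteq> u \<longrightarrow> q' = (q1, - q2, - q3))"
    using pauli_damping_decomposition_unique by (metis prod_cases3)
qed

end
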